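(* Let $a,b\in\mathbb{R}^+$ and consider the rectangular grid with parameters $a,b$. For every $t\in\mathbb{N}$, $$\lambda(t) = \sqrt{(i^\ast-2)^2a^2 + (j^\ast-2)^2 b^2},$$ where $$i^+ = \max\left\{\frac{(t-3)b^2}{a^2+b^2},0\right\}+2,\qquad j^+ = \max\left\{\frac{(t-3)a^2}{a^2+b^2},0\right\}+2,$$ $$i^\ast = \left\lfloor i^+ + \frac12\right\rfloor,\qquad j^\ast = \left\lceil j^+ - \frac12\right\rceil .$$ Equivalently, for $t\geq 3$, $$\lambda(t) = \sqrt{\frac{(t-3)^2a^2b^2}{a^2+b^2} + r^2(a^2+b^2)}\qquad\text{with}\qquad r = |i^\ast - i^+| = |j^\ast-j^+|.$$ The function $\lambda$ is monotone increasing for $t\geq 3$.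
   Context: $\mathbb{N}=\{1,2,3,\dots\}$ and $\mathbb{R}^+=(0,\infty)$. The grid with parameters $a,b\in\mathbb{R}^+$ consists of the lines $x=ka$ and $y=kb$, $k\in\mathbb{Z}$, in $\mathbb{R}^2$; its tiles are the rectangles $[ka,(k+1)a]\times[mb,(m+1)b]$, $k,m\in\mathbb{Z}$. A line segment visits a tile if it intersects the interior of the tile. For $t\in\mathbb{N}$, $\lambda(t)\in[0,\infty)$ is the infimum of the lengths of all line segments (of positive length, with arbitrary position and orientation in the plane) that visit at least $t$ tiles. "Increasing" means strictly increasing (as opposed to non-decreasing). *)

theory Defs
  imports "HOL-Analysis.Analysis"
begin

text \<open>The plane is \<^typ>\<open>real \<times> real\<close>, whose \<^const>\<open>dist\<close> is the Euclidean distance.\<close>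

definition tile :: "real \<Rightarrow> real \<Rightarrow> int \<Rightarrow> int \<Rightarrow> (real \<times> real) set" where
  "tile a b k m = {real_of_int k * a .. (real_of_int k + 1) * a} \<times>
                  {real_of_int m * b .. (real_of_int m + 1) * b}"

definition tiles :: "real \<Rightarrow> real \<Rightarrow> (real \<times> real) set set" where
  "tiles a b = {tile a b k m | k m. True}"

definition visits :: "(real \<times> real) set \<Rightarrow> (real \<times> real) set \<Rightarrow> bool" where
  "visits S T \<longleftrightarrow> S \<inter> interior T \<noteq> {}"

definition visited_tiles :: "real \<Rightarrow> real \<Rightarrow> (real \<times> real) set \<Rightarrow> (real \<times> real) set set" where
  "visited_tiles a b S = {T \<in> tiles a b. visits S T}"

text \<open>For positive \<open>a\<close>, \<open>b\<close> a segment, being bounded, visits only finitely many tiles, so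
  \<^const>\<open>card\<close> is the true number of visited tiles. The set of lengths is nonempty and bounded
  below by 0, so \<^const>\<open>Inf\<close> is the true infimum. The relevant arguments are \<open>t \<ge> 1\<close>.\<close>

definition lambda :: "real \<Rightarrow> real \<Rightarrow> nat \<Rightarrow> real" where
  "lambda a b t =
     Inf {dist P Q | P Q. P \<noteq> Q \<and> t \<le> card (visited_tiles a b (closed_segment P Q))}"

definition i_plus :: "real \<Rightarrow> real \<Rightarrow> nat \<Rightarrow> real" where
  "i_plus a b t = max ((real t - 3) * b\<^sup>2 / (a\<^sup>2 + b\<^sup>2)) 0 + 2"

definition j_plus :: "real \<Rightarrow> real \<Rightarrow> nat \<Rightarrow> real" where
  "j_plus a b t = max ((real t - 3) * a\<^sup>2 / (a\<^sup>2 + b\<^sup>2)) 0 + 2"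

definition i_star :: "real \<Rightarrow> real \<Rightarrow> nat \<Rightarrow> int" where
  "i_star a b t = \<lfloor>i_plus a b t + 1 / 2\<rfloor>"

definition j_star :: "real \<Rightarrow> real \<Rightarrow> nat \<Rightarrow> int" where
  "j_star a b t = \<lceil>j_plus a b t - 1 / 2\<rceil>"

end

theory Submission
  imports Defs
begin

text \<open>The indices of the visited tiles form a chain for the componentwise order (up to reflection),
  so \<open>k + m\<close> (or \<open>k - m\<close>) is injective on them: a segment visiting \<open>t\<close> tiles contains points
  in tiles whose indices differ by \<open>u + 1\<close> and \<open>v + 1\<close> with \<open>t \<le> u + v + 3\<close>, and its sides are
  at least \<open>u a\<close> and \<open>v b\<close>. Conversely, a generic segment slightly longer than the diagonal of a
  \<open>u a\<close> by \<open>v b\<close> block of tiles crosses \<open>u + 1\<close> vertical and \<open>v + 1\<close> horizontal lines at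
  different points, entering a new tile each time. Hence \<open>\<lambda>(t)\<^sup>2\<close> is the minimum of
  \<open>u\<^sup>2 a\<^sup>2 + v\<^sup>2 b\<^sup>2\<close> subject to \<open>u + v \<ge> t - 3\<close>. For equality \<open>u + v = t - 3\<close> this is a quadratic
  in \<open>u\<close>, so the best integer is the one nearest to its real minimizer.\<close>

section \<open>Counting visited tiles by their index pairs\<close>

text \<open>Index pairs carry the componentwise order that the chain argument needs; for positive
  \<open>a\<close>, \<open>b\<close> the map \<open>tile\<close> is injective, so counting pairs
  counts tiles.\<close>

definition visited_indices :: "real \<Rightarrow> real \<Rightarrow> (real \<times> real) set \<Rightarrow> (int \<times> int) set" where
  "visited_indices a b S = {(k, m). visits S (tile a b k m)}"

lemma interior_tile:
  "interior (tile a b k m) = {real_of_int k * a <..< (real_of_int k + 1) * a} \<times>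
                             {real_of_int m * b <..< (real_of_int m + 1) * b}"
  by (simp add: tile_def interior_Times)

lemma visited_indices_iff:
  "(k, m) \<in> visited_indices a b S \<longleftrightarrow>
     (\<exists>x y. (x, y) \<in> S \<and> real_of_int k * a < x \<and> x < (real_of_int k + 1) * a
                   \<and> real_of_int m * b < y \<and> y < (real_of_int m + 1) * b)"
  by (auto simp: visited_indices_def visits_def interior_tile)

lemma inj_tile:
  assumes "a > 0" "b > 0"
  shows "inj (\<lambda>(k, m). tile a b k m)"
proof (rule injI, clarify)
  fix k m k' m' assume "tile a b k m = tile a b k' m'"
  \<comment> \<open>The intervals are nonempty, so equal products have equal factors and equal
    intervals have equal endpoints.\<close>
  moreover have "real_of_int i * c \<le> (real_of_int i + 1) * c" if "c > 0" for c i
    using that by (simp add: algebra_simps)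
  ultimately show "k = k' \<and> m = m'"
    using assms by (auto simp: tile_def times_eq_iff Icc_eq_Icc not_le[symmetric])
qed

lemma card_visited_tiles:
  assumes "a > 0" "b > 0"
  shows "card (visited_tiles a b S) = card (visited_indices a b S)"
proof -
  have "visited_tiles a b S = (\<lambda>(k, m). tile a b k m) ` visited_indices a b S"
    by (auto simp: visited_tiles_def tiles_def visited_indices_def)
  then show ?thesis
    using inj_on_subset[OF inj_tile[OF assms]] by (simp add: card_image)
qed

section \<open>Lower bound for the length of a segment\<close>

lemma tile_index_mono:
  fixes c x x' :: real
  assumes "c > 0" "real_of_int k * c < x" "x \<le> x'" "x' < (real_of_int k' + 1) * c"
  shows "k \<le> k'"
proof -
  have "real_of_int k * c < (real_of_int k' + 1) * c" using assms by linarith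
  then have "real_of_int k < real_of_int k' + 1" using assms(1) by simp
  then show ?thesis by linarith
qed

text \<open>All cells strictly between the two given ones are crossed in full; \<open>nat\<close>
  turns the count -1 for equal indices into 0.\<close>

lemma tile_index_gap:
  fixes c x x' :: real
  assumes "c > 0" "real_of_int k * c < x" "x < (real_of_int k + 1) * c"
    "real_of_int k' * c < x'" "x' < (real_of_int k' + 1) * c"
  shows "real (nat (\<bar>k' - k\<bar> - 1)) * c \<le> \<bar>x' - x\<bar>"
proof (cases "k = k'")
  case False
  then have "real (nat (\<bar>k' - k\<bar> - 1)) = \<bar>real_of_int k' - real_of_int k\<bar> - 1" by simp
  then show ?thesis using assms by (auto simp: algebra_simps abs_if)
qed auto

text \<open>Along the chain \<open>k + \<sigma> * m\<close> is strictly monotone, so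
  \<open>V\<close> injects into an integer interval whose ends are values at two members of
  \<open>V\<close>. The case \<open>\<sigma> = -1\<close> covers descending chains.\<close>

lemma card_chain_le:
  fixes V :: "(int \<times> int) set" and \<sigma> :: int
  assumes "finite V" "V \<noteq> {}" and \<sigma>: "\<bar>\<sigma>\<bar> = 1"
    and chain: "\<And>k m k' m'. (k, m) \<in> V \<Longrightarrow> (k', m') \<in> V \<Longrightarrow>
      k \<le> k' \<and> \<sigma> * m \<le> \<sigma> * m' \<or> k' \<le> k \<and> \<sigma> * m' \<le> \<sigma> * m"
  obtains k m k' m' where "(k, m) \<in> V" "(k', m') \<in> V"
    "int (card V) \<le> \<bar>k' - k\<bar> + \<bar>m' - m\<bar> + 1"
proof -
  define f where "f = (\<lambda>(k, m). k + \<sigma> * m)"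
  have s: "\<sigma> = 1 \<or> \<sigma> = -1" using \<sigma> by linarith
  have inj: "inj_on f V"
    using chain s by (force simp: inj_on_def f_def)
  have fin: "finite (f ` V)" "f ` V \<noteq> {}" using assms by auto
  obtain k m where km: "(k, m) \<in> V" "f (k, m) = Min (f ` V)"
    using Min_in[OF fin] by force
  obtain k' m' where km': "(k', m') \<in> V" "f (k', m') = Max (f ` V)"
    using Max_in[OF fin] by force
  have "f ` V \<subseteq> {f (k, m) .. f (k', m')}" using fin km km' by auto
  then have "card V \<le> nat (f (k', m') - f (k, m) + 1)"
    using card_mono[of "{f (k, m) .. f (k', m')}" "f ` V"] card_image[OF inj] by simp
  moreover have "f (k, m) \<le> f (k', m')" using fin km km' by simp
  ultimately have "int (card V) \<le> \<bar>k' - k\<bar> + \<bar>m' - m\<bar> + 1"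
    using s by (auto simp: f_def)
  with km km' that show ?thesis by blast
qed

lemma dist_ge_of_card_visited_tiles:
  assumes ab: "a > 0" "b > 0" and t: "1 \<le> t" "t \<le> card (visited_tiles a b (closed_segment P Q))"
  obtains u v :: nat where "t \<le> u + v + 3" "sqrt ((real u)\<^sup>2 * a\<^sup>2 + (real v)\<^sup>2 * b\<^sup>2) \<le> dist P Q"
proof -
  define V where "V = visited_indices a b (closed_segment P Q)"
  have cV: "t \<le> card V" using t card_visited_tiles[OF ab] by (simp add: V_def)
  \<comment> \<open>An infinite set has \<open>card\<close> 0, so \<open>t\<close> \<ge> 1 yields
    finiteness as well as nonemptiness.\<close>
  then have V: "finite V" "V \<noteq> {}" using t card.infinite by fastforce+
  define d where "d = (fst Q - fst P) * (snd Q - snd P)"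
  \<comment> \<open>The sign of the slope; axis-parallel segments have \<open>d = 0\<close> and
    count as ascending.\<close>
  define \<sigma> :: int where "\<sigma> = (if d \<ge> 0 then 1 else -1)"
  have param: "\<exists>s. (x, y) = P + s *\<^sub>R (Q - P) \<and> 0 \<le> s \<and> s \<le> 1" if "(x, y) \<in> closed_segment P Q" for x y
    using that by (auto simp: closed_segment_def algebra_simps)
  have chain: "k \<le> k' \<and> \<sigma> * m \<le> \<sigma> * m' \<or> k' \<le> k \<and> \<sigma> * m' \<le> \<sigma> * m"
    if "(k, m) \<in> V" "(k', m') \<in> V" for k m k' m'
  proof -
    obtain x y where xy: "(x, y) \<in> closed_segment P Q"
        "real_of_int k * a < x" "x < (real_of_int k + 1) * a"
        "real_of_int m * b < y" "y < (real_of_int m + 1) * b"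
      using \<open>(k, m) \<in> V\<close> by (auto simp: V_def visited_indices_iff)
    obtain x' y' where xy': "(x', y') \<in> closed_segment P Q"
        "real_of_int k' * a < x'" "x' < (real_of_int k' + 1) * a"
        "real_of_int m' * b < y'" "y' < (real_of_int m' + 1) * b"
      using \<open>(k', m') \<in> V\<close> by (auto simp: V_def visited_indices_iff)
    obtain s where s: "(x, y) = P + s *\<^sub>R (Q - P)" using param xy by blast
    obtain s' where s': "(x', y') = P + s' *\<^sub>R (Q - P)" using param xy' by blast
    have "(x', y') - (x, y) = (s' - s) *\<^sub>R (Q - P)"
      unfolding s s' by (simp add: algebra_simps)
    then have "x' - x = (s' - s) * (fst Q - fst P)" "y' - y = (s' - s) * (snd Q - snd P)"
      by (auto simp: prod_eq_iff)
    then have "(x' - x) * (y' - y) = (s' - s)\<^sup>2 * d"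
      by (simp add: d_def power2_eq_square)
    \<comment> \<open>By the choice of \<open>\<sigma>\<close>, the product
      \<open>\<sigma> * d\<close> is the absolute value of \<open>d\<close>.\<close>
    then have "0 \<le> of_int \<sigma> * ((x' - x) * (y' - y))"
      by (auto simp: \<sigma>_def zero_le_mult_iff mult_le_0_iff)
    then have *: "x \<le> x' \<and> real_of_int \<sigma> * y \<le> real_of_int \<sigma> * y' \<or>
        x' \<le> x \<and> real_of_int \<sigma> * y' \<le> real_of_int \<sigma> * y"
      by (auto simp: \<sigma>_def zero_le_mult_iff mult_le_0_iff split: if_splits)
    note mono = tile_index_mono[OF ab(1) xy(2) _ xy'(3)] tile_index_mono[OF ab(1) xy'(2) _ xy(3)]
      tile_index_mono[OF ab(2) xy(4) _ xy'(5)] tile_index_mono[OF ab(2) xy'(4) _ xy(5)]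
    show ?thesis
      using * mono by (auto simp: \<sigma>_def split: if_splits)
  qed
  have "\<bar>\<sigma>\<bar> = 1" by (simp add: \<sigma>_def)
  from card_chain_le[OF V this chain] obtain k m k' m' where km: "(k, m) \<in> V" "(k', m') \<in> V"
    and c: "int (card V) \<le> \<bar>k' - k\<bar> + \<bar>m' - m\<bar> + 1" by blast
  obtain x y where xy: "(x, y) \<in> closed_segment P Q"
      "real_of_int k * a < x" "x < (real_of_int k + 1) * a"
      "real_of_int m * b < y" "y < (real_of_int m + 1) * b"
    using km by (auto simp: V_def visited_indices_iff)
  obtain x' y' where xy': "(x', y') \<in> closed_segment P Q"
      "real_of_int k' * a < x'" "x' < (real_of_int k' + 1) * a"
      "real_of_int m' * b < y'" "y' < (real_of_int m' + 1) * b"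
    using km by (auto simp: V_def visited_indices_iff)
  obtain s where s: "(x, y) = P + s *\<^sub>R (Q - P)" "0 \<le> s" "s \<le> 1" using param xy by blast
  obtain s' where s': "(x', y') = P + s' *\<^sub>R (Q - P)" "0 \<le> s'" "s' \<le> 1" using param xy' by blast
  define u v where "u = nat (\<bar>k' - k\<bar> - 1)" and "v = nat (\<bar>m' - m\<bar> - 1)"
  have "real u * a \<le> \<bar>x' - x\<bar>" "real v * b \<le> \<bar>y' - y\<bar>"
    unfolding u_def v_def
    using tile_index_gap[OF ab(1) xy(2,3) xy'(2,3)] tile_index_gap[OF ab(2) xy(4,5) xy'(4,5)] by auto
  then have "(real u * a)\<^sup>2 \<le> (x' - x)\<^sup>2" "(real v * b)\<^sup>2 \<le> (y' - y)\<^sup>2"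
    using ab by (auto simp flip: abs_le_square_iff)
  then have "sqrt ((real u)\<^sup>2 * a\<^sup>2 + (real v)\<^sup>2 * b\<^sup>2) \<le> dist (x', y') (x, y)"
    by (simp add: dist_Pair_Pair dist_real_def power_mult_distrib)
  also have "\<dots> = norm ((s' - s) *\<^sub>R (Q - P))"
    by (simp add: s s' dist_norm algebra_simps)
  also have "\<dots> \<le> 1 * norm (Q - P)"
    unfolding norm_scaleR using s s' by (intro mult_right_mono) auto
  also have "\<dots> = dist P Q" by (simp add: dist_norm norm_minus_commute)
  finally have "sqrt ((real u)\<^sup>2 * a\<^sup>2 + (real v)\<^sup>2 * b\<^sup>2) \<le> dist P Q" .
  \<comment> \<open>The index differences are at most \<open>u + 1\<close> and \<open>v + 1\<close>;
    the remaining 1 comes from \<open>c\<close>.\<close>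
  moreover have "t \<le> u + v + 3" using c cV by (simp add: u_def v_def)
  ultimately show ?thesis using that by blast
qed

section \<open>Construction of short segments visiting many tiles\<close>

text \<open>Bounding \<open>card\<close> from below by a subset requires a finite superset, since
  \<open>card\<close> is 0 on infinite sets.\<close>

lemma finite_visited_indices:
  assumes ab: "a > 0" "b > 0" and "bounded S"
  shows "finite (visited_indices a b S)"
proof -
  from \<open>bounded S\<close> obtain M where M: "\<And>z. z \<in> S \<Longrightarrow> norm z \<le> M" by (auto simp: bounded_iff)
  have range: "k \<in> {\<lfloor>- M / c\<rfloor> .. \<lceil>M / c\<rceil>}"
    if "c > 0" "real_of_int k * c < x" "x < (real_of_int k + 1) * c" "\<bar>x\<bar> \<le> M" for c x k
  proof -
    have "real_of_int k * c < M" "- M < (real_of_int k + 1) * c" using that by linarith+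
    then have "real_of_int k < M / c" "- M / c < real_of_int k + 1"
      using \<open>c > 0\<close> by (auto simp: field_simps)
    then show ?thesis by (simp add: floor_le_iff le_ceiling_iff)
  qed
  have "visited_indices a b S \<subseteq> {\<lfloor>- M / a\<rfloor> .. \<lceil>M / a\<rceil>} \<times> {\<lfloor>- M / b\<rfloor> .. \<lceil>M / b\<rceil>}"
  proof (rule subrelI)
    fix k m assume "(k, m) \<in> visited_indices a b S"
    then obtain x y where xy: "(x, y) \<in> S"
      "real_of_int k * a < x" "x < (real_of_int k + 1) * a"
      "real_of_int m * b < y" "y < (real_of_int m + 1) * b"
      by (auto simp: visited_indices_iff)
    have "\<bar>x\<bar> \<le> M" "\<bar>y\<bar> \<le> M"
      using M[OF xy(1)] norm_fst_le[of x y] norm_snd_le[of y x] by auto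
    then show "(k, m) \<in> {\<lfloor>- M / a\<rfloor> .. \<lceil>M / a\<rceil>} \<times> {\<lfloor>- M / b\<rfloor> .. \<lceil>M / b\<rceil>}"
      using range ab xy by blast
  qed
  then show ?thesis by (rule finite_subset) auto
qed

text \<open>Strict growth gives the lower inequality even if the value at \<open>s\<close> is an
  integer, hence the one-sided neighbourhood; continuity gives the upper one.\<close>

lemma floor_right_neighbourhood:
  fixes p q s :: real
  assumes "q > 0"
  shows "\<forall>\<^sub>F s' in at_right s. real_of_int \<lfloor>p + q * s\<rfloor> < p + q * s' \<and> p + q * s' < real_of_int \<lfloor>p + q * s\<rfloor> + 1"
proof (rule eventually_conj)
  have "\<forall>\<^sub>F s' in at_right s. s < s'" by (simp add: eventually_at_right_less)
  then show "\<forall>\<^sub>F s' in at_right s. real_of_int \<lfloor>p + q * s\<rfloor> < p + q * s'"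
  proof eventually_elim
    case (elim s')
    then have "p + q * s < p + q * s'" using assms by simp
    then show ?case using of_int_floor_le[of "p + q * s"] by linarith
  qed
  have "((\<lambda>s'. p + q * s') \<longlongrightarrow> p + q * s) (at_right s)" by (intro tendsto_intros)
  then show "\<forall>\<^sub>F s' in at_right s. p + q * s' < real_of_int \<lfloor>p + q * s\<rfloor> + 1"
    by (rule order_tendstoD) simp
qed

text \<open>Immediately after \<open>s\<close> both coordinates have left the grid lines but still have the same floor,
  so points on grid lines need no special treatment.\<close>

lemma floor_mem_visited_indices:
  assumes ab: "a > 0" "b > 0" and "q > 0" "q' > 0" "0 \<le> s" "s < 1"
  shows "(\<lfloor>p + q * s\<rfloor>, \<lfloor>p' + q' * s\<rfloor>) \<in>
    visited_indices a b (closed_segment (p * a, p' * b) ((p + q) * a, (p' + q') * b))"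
proof -
  have "\<forall>\<^sub>F s' in at_right s. s' < 1"
    using \<open>s < 1\<close> by (rule order_tendstoD[OF tendsto_ident_at])
  then have "\<forall>\<^sub>F s' in at_right s. s < s' \<and> s' < 1
    \<and> (real_of_int \<lfloor>p + q * s\<rfloor> < p + q * s' \<and> p + q * s' < real_of_int \<lfloor>p + q * s\<rfloor> + 1)
    \<and> (real_of_int \<lfloor>p' + q' * s\<rfloor> < p' + q' * s' \<and> p' + q' * s' < real_of_int \<lfloor>p' + q' * s\<rfloor> + 1)"
    using assms by (intro eventually_conj floor_right_neighbourhood eventually_at_right_less)
  from eventually_happens[OF this] obtain s' where s': "s < s'" "s' < 1"
    "real_of_int \<lfloor>p + q * s\<rfloor> < p + q * s'" "p + q * s' < real_of_int \<lfloor>p + q * s\<rfloor> + 1"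
    "real_of_int \<lfloor>p' + q' * s\<rfloor> < p' + q' * s'" "p' + q' * s' < real_of_int \<lfloor>p' + q' * s\<rfloor> + 1"
    by auto
  have "((p + q * s') * a, (p' + q' * s') * b)
      \<in> closed_segment (p * a, p' * b) ((p + q) * a, (p' + q') * b)"
    unfolding closed_segment_def using s' \<open>0 \<le> s\<close>
    by (intro CollectI exI[of _ s']) (auto simp: algebra_simps)
  then show ?thesis
    unfolding visited_indices_iff using s' ab
    by (intro exI[of _ "(p + q * s') * a"] exI[of _ "(p' + q' * s') * b"]) auto
qed

text \<open>The diagonal of the block is prolonged so that its extents grow by \<open>2 * e\<close>
  in grid units. The starting tile and the \<open>(u + 1) + (v + 1)\<close> crossings give
  \<open>u + v + 3\<close> tiles.\<close>

lemma exists_segment_visiting: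
  assumes ab: "a > 0" "b > 0" and e: "e > 0"
  obtains P Q where "P \<noteq> Q" "u + v + 3 \<le> card (visited_tiles a b (closed_segment P Q))"
    "dist P Q = sqrt ((real u + 2 * e)\<^sup>2 * a\<^sup>2 + (real v + 2 * e)\<^sup>2 * b\<^sup>2)"
proof -
  define q q' where "q = real u + 2 * e" and "q' = real v + 2 * e"
  have q: "q > 0" "q' > 0" using e by (auto simp: q_def q'_def)
  \<comment> \<open>The parameter at which the segment meets the vertical line of index
    \<open>i\<close>; in units of \<open>a\<close> the first coordinate starts at
    \<open>- e\<close>.\<close>
  define r where "r = (\<lambda>i::nat. (real i + e) / q)"
  \<comment> \<open>A generic vertical shift keeps the segment away from the lattice points.\<close>
  define B where "B = (\<lambda>(i, j). real j + e - q' * r i) ` ({..u} \<times> {..v})"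
  have "infinite ({0<..<e} - B)"
    using e unfolding B_def by (intro Diff_infinite_finite) auto
  then obtain \<tau> where "\<tau> \<in> {0<..<e} - B"
    by (metis ex_in_conv finite.emptyI)
  then have \<tau>: "0 < \<tau>" "\<tau> < e" "\<tau> \<notin> B" by auto
  have gen: "\<tau> \<noteq> real j + e - q' * r i" if "i \<le> u" "j \<le> v" for i j
    using that \<tau>(3) unfolding B_def by (metis (no_types, lifting) SigmaI atMost_iff case_prod_conv image_eqI)
  \<comment> \<open>The same for the horizontal line of index \<open>j\<close>, with starting height
    \<open>\<tau> - e\<close> in units of \<open>b\<close>.\<close>
  define r' where "r' = (\<lambda>j::nat. (real j + e - \<tau>) / q')"
  define p p' where "p = - e" and "p' = \<tau> - e"
  define X Y where "X = (\<lambda>s. p + q * s)" and "Y = (\<lambda>s. p' + q' * s)"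
  have Xr: "X (r i) = real i" for i using q by (simp add: X_def p_def r_def)
  have Yr: "Y (r' j) = real j" for j using q by (simp add: Y_def p'_def r'_def)
  \<comment> \<open>The parameters of all crossings; the parameter 0, added below, stands for the
    tile entered at the start.\<close>
  define C where "C = r ` {..u} \<union> r' ` {..v}"
  \<comment> \<open>The bound \<open>\<tau> < e\<close> places the start below the horizontal line
    of index 0.\<close>
  have C01: "0 < s \<and> s < 1" if "s \<in> C" for s
    using that \<tau> e q by (auto simp: C_def r_def r'_def) (auto simp: q_def q'_def)
  have "inj r" "inj r'" using Xr Yr by (metis injI of_nat_eq_iff)+
  moreover have "r i \<noteq> r' j" if "i \<le> u" "j \<le> v" for i j
    using gen[OF that] q by (auto simp: r'_def field_simps)
  then have "r ` {..u} \<inter> r' ` {..v} = {}" by auto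
  ultimately have "card C = u + v + 2"
    by (simp add: C_def card_Un_disjoint card_image inj_on_subset)
  then have card0: "card (insert 0 C) = u + v + 3"
    using C01 by (subst card_insert_disjoint) (auto simp: C_def)
  have new: "(\<lfloor>X s\<rfloor>, \<lfloor>Y s\<rfloor>) \<noteq> (\<lfloor>X s'\<rfloor>, \<lfloor>Y s'\<rfloor>)" if "s < s'" "s' \<in> C" for s s'
  proof -
    have lt: "X s < X s'" "Y s < Y s'" using that q by (auto simp: X_def Y_def)
    \<comment> \<open>At a crossing one coordinate is an integer, and this integer exceeds the floor
      of every smaller value.\<close>
    have "X s' \<in> \<int> \<or> Y s' \<in> \<int>" using that by (auto simp: C_def Xr Yr)
    then have "\<lfloor>X s\<rfloor> < \<lfloor>X s'\<rfloor> \<or> \<lfloor>Y s\<rfloor> < \<lfloor>Y s'\<rfloor>"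
      using lt by (auto elim!: Ints_cases simp: floor_less_iff)
    then show ?thesis by auto
  qed
  have "inj_on (\<lambda>s. (\<lfloor>X s\<rfloor>, \<lfloor>Y s\<rfloor>)) (insert 0 C)"
  proof (rule linorder_inj_onI')
    fix s s' assume "s \<in> insert 0 C" "s' \<in> insert 0 C" "s < s'"
    then have "s' \<in> C" using C01[of s] by auto
    then show "(\<lfloor>X s\<rfloor>, \<lfloor>Y s\<rfloor>) \<noteq> (\<lfloor>X s'\<rfloor>, \<lfloor>Y s'\<rfloor>)" using new \<open>s < s'\<close> by blast
  qed
  then have card_im: "card ((\<lambda>s. (\<lfloor>X s\<rfloor>, \<lfloor>Y s\<rfloor>)) ` insert 0 C) = u + v + 3"
    using card0 by (simp only: card_image)
  define P Q where "P = (p * a, p' * b)" and "Q = ((p + q) * a, (p' + q') * b)"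
  have "(\<lambda>s. (\<lfloor>X s\<rfloor>, \<lfloor>Y s\<rfloor>)) ` insert 0 C \<subseteq> visited_indices a b (closed_segment P Q)"
    unfolding X_def Y_def P_def Q_def
  proof (intro image_subsetI floor_mem_visited_indices ab q)
    fix s assume "s \<in> insert 0 C"
    then show "0 \<le> s" "s < 1" using C01[of s] by auto
  qed
  then have "u + v + 3 \<le> card (visited_tiles a b (closed_segment P Q))"
    unfolding card_visited_tiles[OF ab] card_im[symmetric]
    by (intro card_mono finite_visited_indices ab bounded_closed_segment)
  moreover have "P \<noteq> Q" using q ab by (auto simp: P_def Q_def)
  moreover have "dist P Q = sqrt (q\<^sup>2 * a\<^sup>2 + q'\<^sup>2 * b\<^sup>2)"
  proof -
    have "dist P Q = sqrt ((p * a - (p + q) * a)\<^sup>2 + (p' * b - (p' + q') * b)\<^sup>2)"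
      by (simp add: P_def Q_def dist_Pair_Pair dist_real_def)
    also have "p * a - (p + q) * a = - (q * a)" by (simp add: algebra_simps)
    also have "p' * b - (p' + q') * b = - (q' * b)" by (simp add: algebra_simps)
    finally show ?thesis by (simp add: power_mult_distrib)
  qed
  ultimately show ?thesis using that unfolding q_def q'_def by blast
qed

section \<open>The infimum as a discrete minimum\<close>

text \<open>The constructed lengths \<open>L e\<close> bound the infimum for every positive
  \<open>e\<close>; by continuity so does \<open>L 0\<close>, the diagonal of the block.\<close>

lemma lambda_le:
  assumes ab: "a > 0" "b > 0" and t: "t \<le> u + v + 3"
  shows "lambda a b t \<le> sqrt ((real u)\<^sup>2 * a\<^sup>2 + (real v)\<^sup>2 * b\<^sup>2)"
proof -
  define L where "L = (\<lambda>e. sqrt ((real u + 2 * e)\<^sup>2 * a\<^sup>2 + (real v + 2 * e)\<^sup>2 * b\<^sup>2))"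
  have "lambda a b t \<le> L e" if e: "e > 0" for e
  proof -
    obtain P Q where PQ: "P \<noteq> Q" "u + v + 3 \<le> card (visited_tiles a b (closed_segment P Q))"
      "dist P Q = L e"
      using exists_segment_visiting[OF ab e] unfolding L_def by metis
    show ?thesis
      unfolding lambda_def
    proof (rule cInf_lower)
      show "bdd_below {dist P Q |P Q. P \<noteq> Q \<and> t \<le> card (visited_tiles a b (closed_segment P Q))}"
        by (rule bdd_belowI[of _ 0]) auto
      show "L e \<in> {dist P Q |P Q. P \<noteq> Q \<and> t \<le> card (visited_tiles a b (closed_segment P Q))}"
        using PQ t by (intro CollectI exI[of _ P] exI[of _ Q]) auto
    qed
  qed
  then have "\<forall>\<^sub>F e in at_right 0. lambda a b t \<le> L e"
    using eventually_at_right_less[of "0::real"] by (auto elim: eventually_mono)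
  moreover have "(L \<longlongrightarrow> L 0) (at_right 0)"
    unfolding L_def by (intro tendsto_intros)
  ultimately have "lambda a b t \<le> L 0"
    by (intro tendsto_lowerbound) auto
  then show ?thesis by (simp add: L_def)
qed

text \<open>Every admissible segment is at least as long as the diagonal of some block with
  \<open>t \<le> u + v + 3\<close>.\<close>

lemma lambda_ge:
  assumes ab: "a > 0" "b > 0" and "1 \<le> t"
    and le: "\<And>u v :: nat. t \<le> u + v + 3 \<Longrightarrow> c \<le> sqrt ((real u)\<^sup>2 * a\<^sup>2 + (real v)\<^sup>2 * b\<^sup>2)"
  shows "c \<le> lambda a b t"
  unfolding lambda_def
proof (rule cInf_greatest)
  \<comment> \<open>The greatest-lower-bound rule needs a nonempty set; a block with
    \<open>u = t\<close>, \<open>v = 0\<close> and \<open>e = 1\<close> supplies a member.\<close>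
  obtain P Q where "P \<noteq> Q" "t + 0 + 3 \<le> card (visited_tiles a b (closed_segment P Q))"
    by (rule exists_segment_visiting[OF ab zero_less_one])
  then have "dist P Q \<in> {dist P Q |P Q. P \<noteq> Q \<and> t \<le> card (visited_tiles a b (closed_segment P Q))}"
    by (intro CollectI exI[of _ P] exI[of _ Q]) auto
  then show "{dist P Q |P Q. P \<noteq> Q \<and> t \<le> card (visited_tiles a b (closed_segment P Q))} \<noteq> {}"
    by blast
next
  fix d assume "d \<in> {dist P Q |P Q. P \<noteq> Q \<and> t \<le> card (visited_tiles a b (closed_segment P Q))}"
  then obtain P Q where d: "d = dist P Q"
    and "t \<le> card (visited_tiles a b (closed_segment P Q))" by blast
  then obtain u v :: nat where "t \<le> u + v + 3" "sqrt ((real u)\<^sup>2 * a\<^sup>2 + (real v)\<^sup>2 * b\<^sup>2) \<le> dist P Q"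
    using dist_ge_of_card_visited_tiles[OF ab \<open>1 \<le> t\<close>] by blast
  then show "c \<le> d"
    using le d by fastforce
qed

section \<open>Minimization by rounding\<close>

text \<open>Completing the square in \<open>x\<close>; for \<open>n = t - 3\<close> \<ge> 0 the
  vertex is \<open>i_plus a b t - 2\<close>.\<close>

lemma split_quadratic:
  fixes a b n x :: real
  assumes "a > 0" "b > 0"
  shows "x\<^sup>2 * a\<^sup>2 + (n - x)\<^sup>2 * b\<^sup>2 =
    n\<^sup>2 * a\<^sup>2 * b\<^sup>2 / (a\<^sup>2 + b\<^sup>2) + (x - n * b\<^sup>2 / (a\<^sup>2 + b\<^sup>2))\<^sup>2 * (a\<^sup>2 + b\<^sup>2)"
proof -
  define s where "s = a\<^sup>2 + b\<^sup>2"
  have "s \<noteq> 0" using assms by (simp add: s_def sum_power2_eq_zero_iff)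
  have "n\<^sup>2 * a\<^sup>2 * b\<^sup>2 / s + (x - n * b\<^sup>2 / s)\<^sup>2 * s
      = n\<^sup>2 * b\<^sup>2 * (a\<^sup>2 + b\<^sup>2) / s + x\<^sup>2 * s - 2 * x * n * b\<^sup>2"
    using \<open>s \<noteq> 0\<close> by (simp add: field_simps power2_eq_square)
  also have "\<dots> = n\<^sup>2 * b\<^sup>2 + x\<^sup>2 * s - 2 * x * n * b\<^sup>2"
    using \<open>s \<noteq> 0\<close> by (simp flip: s_def)
  also have "\<dots> = x\<^sup>2 * a\<^sup>2 + (n - x)\<^sup>2 * b\<^sup>2"
    by (simp add: s_def power2_eq_square algebra_simps)
  finally show ?thesis by (simp add: s_def)
qed

text \<open>Truncated subtraction of natural numbers takes over the role of the maximum with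
  0.\<close>

lemma i_plus_eq: "i_plus a b t = real (t - 3) * b\<^sup>2 / (a\<^sup>2 + b\<^sup>2) + 2"
proof (cases "3 \<le> t")
  case False
  then have "(real t - 3) * b\<^sup>2 / (a\<^sup>2 + b\<^sup>2) \<le> 0"
    by (intro divide_nonpos_nonneg mult_nonpos_nonneg) auto
  then show ?thesis using False by (simp add: i_plus_def)
qed (simp add: i_plus_def of_nat_diff)

lemma j_plus_eq:
  assumes "a > 0"
  shows "j_plus a b t = real (t - 3) - (i_plus a b t - 2) + 2"
proof -
  have "a\<^sup>2 + b\<^sup>2 \<noteq> 0" using assms by (simp add: sum_power2_eq_zero_iff)
  then have "real (t - 3) - (i_plus a b t - 2) = real (t - 3) * a\<^sup>2 / (b\<^sup>2 + a\<^sup>2)"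
    unfolding i_plus_eq by (simp add: field_simps)
  moreover have "j_plus a b t = i_plus b a t" by (simp add: i_plus_def j_plus_def add.commute)
  ultimately show ?thesis by (simp add: i_plus_eq)
qed

text \<open>Rounding half up is exactly \<open>round\<close>, which makes its nearest-integer
  property available.\<close>

lemma i_star_eq: "i_star a b t = round (i_plus a b t - 2) + 2"
proof -
  have "i_plus a b t + 1 / 2 = (i_plus a b t - 2 + 1 / 2) + of_int 2" by simp
  then show ?thesis by (simp only: i_star_def round_def floor_add_int)
qed

text \<open>Negation exchanges floor and ceiling, so the two rounding conventions are complementary
  and the sum stays exact at ties.\<close>

lemma j_star_eq:
  assumes "a > 0"
  shows "j_star a b t = int (t - 3) - (i_star a b t - 2) + 2"
proof -
  have "j_plus a b t - 1 / 2 = - (i_plus a b t + 1 / 2) + of_int (int (t - 3) + 4)"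
    using assms by (simp add: j_plus_eq)
  then show ?thesis
    by (simp only: j_star_def i_star_def ceiling_add_of_int ceiling_minus)
qed

lemma lambda_eq:
  assumes ab: "a > 0" "b > 0" and t: "t \<ge> 1"
  obtains u v :: nat where "u + v = t - 3" "i_star a b t = int u + 2" "j_star a b t = int v + 2"
    "lambda a b t = sqrt ((real u)\<^sup>2 * a\<^sup>2 + (real v)\<^sup>2 * b\<^sup>2)"
proof -
  define n where "n = t - 3"
  define x where "x = i_plus a b t - 2"
  have x: "x = real n * b\<^sup>2 / (a\<^sup>2 + b\<^sup>2)" by (simp add: x_def i_plus_eq n_def)
  have pos: "a\<^sup>2 + b\<^sup>2 > 0" using ab by (simp add: add_pos_pos)
  have x0: "0 \<le> x" "x \<le> real n" using pos by (auto simp: x field_simps)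
  \<comment> \<open>Rounding does not leave the interval from 0 to \<open>n\<close>, so
    \<open>v = n - u\<close> is not truncated.\<close>
  then have rd: "0 \<le> round x" "round x \<le> int n"
    using round_mono[OF x0(1)] round_mono[OF x0(2)] by auto
  define u v where "u = nat (round x)" and "v = n - u"
  have uv: "u + v = n" "int u = round x" using rd by (auto simp: u_def v_def)
  have i: "i_star a b t = int u + 2" by (simp add: i_star_eq uv x_def)
  have j: "j_star a b t = int v + 2" using uv by (simp add: j_star_eq[OF ab(1)] i n_def flip: of_nat_add)
  have min: "sqrt ((real u)\<^sup>2 * a\<^sup>2 + (real v)\<^sup>2 * b\<^sup>2) \<le> sqrt ((real p)\<^sup>2 * a\<^sup>2 + (real q)\<^sup>2 * b\<^sup>2)"
    if "t \<le> p + q + 3" for p q :: nat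
  proof -
    \<comment> \<open>Capping \<open>p\<close> at \<open>n\<close> reduces the constraint to pairs
      with sum exactly \<open>n\<close>, without increasing either side.\<close>
    define p' where "p' = min p n"
    have "real p' \<le> real p" "real n - real p' \<le> real q" "0 \<le> real n - real p'"
      using that by (auto simp: p'_def n_def)
    then have "(real p')\<^sup>2 * a\<^sup>2 + (real n - real p')\<^sup>2 * b\<^sup>2 \<le> (real p)\<^sup>2 * a\<^sup>2 + (real q)\<^sup>2 * b\<^sup>2"
      by (intro add_mono mult_right_mono power_mono) auto
    \<comment> \<open>With the square completed, only the distance to the vertex \<open>x\<close>
      matters, and \<open>u\<close> is a nearest integer.\<close>
    moreover have "\<bar>real u - x\<bar> \<le> \<bar>real p' - x\<bar>"
      using round_diff_minimal[of x "int p'"] uv by (simp add: abs_minus_commute)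
    then have "(real u - x)\<^sup>2 * (a\<^sup>2 + b\<^sup>2) \<le> (real p' - x)\<^sup>2 * (a\<^sup>2 + b\<^sup>2)"
      using pos by (auto simp: abs_le_square_iff)
    then have "(real u)\<^sup>2 * a\<^sup>2 + (real n - real u)\<^sup>2 * b\<^sup>2 \<le> (real p')\<^sup>2 * a\<^sup>2 + (real n - real p')\<^sup>2 * b\<^sup>2"
      unfolding split_quadratic[OF ab] x by simp
    moreover have "real v = real n - real u" using uv by linarith
    ultimately show ?thesis by simp
  qed
  have "lambda a b t = sqrt ((real u)\<^sup>2 * a\<^sup>2 + (real v)\<^sup>2 * b\<^sup>2)"
  proof (rule antisym)
    show "lambda a b t \<le> sqrt ((real u)\<^sup>2 * a\<^sup>2 + (real v)\<^sup>2 * b\<^sup>2)"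
      using uv by (intro lambda_le ab) (auto simp: n_def)
    show "sqrt ((real u)\<^sup>2 * a\<^sup>2 + (real v)\<^sup>2 * b\<^sup>2) \<le> lambda a b t"
      using min by (rule lambda_ge[OF ab t])
  qed
  with that i j uv show ?thesis unfolding n_def by blast
qed

section \<open>Monotonicity and the closed formulas\<close>

text \<open>Lowering a positive side of an optimal block for \<open>t'\<close> by one leaves a block
  admissible for \<open>t\<close> with a strictly shorter diagonal.\<close>

lemma strict_mono_on_lambda:
  assumes ab: "a > 0" "b > 0"
  shows "strict_mono_on {3..} (lambda a b)"
proof (rule strict_mono_onI)
  fix t t' :: nat assume t: "t \<in> {3..}" "t < t'"
  then have "t' \<ge> 1" by simp
  from lambda_eq[OF ab this] obtain u v :: nat where uv: "u + v = t' - 3"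
    and l: "lambda a b t' = sqrt ((real u)\<^sup>2 * a\<^sup>2 + (real v)\<^sup>2 * b\<^sup>2)" by blast
  have "u + v > 0" using uv t by simp
  then consider "u > 0" | "v > 0" by auto
  then show "lambda a b t < lambda a b t'"
  proof cases
    case 1
    then have "lambda a b t \<le> sqrt ((real (u - 1))\<^sup>2 * a\<^sup>2 + (real v)\<^sup>2 * b\<^sup>2)"
      using uv t by (intro lambda_le ab) auto
    also have "\<dots> < lambda a b t'"
      unfolding l using 1 ab by (auto intro!: mult_strict_right_mono power_strict_mono)
    finally show ?thesis .
  next
    case 2
    then have "lambda a b t \<le> sqrt ((real u)\<^sup>2 * a\<^sup>2 + (real (v - 1))\<^sup>2 * b\<^sup>2)"
      using uv t by (intro lambda_le ab) auto
    also have "\<dots> < lambda a b t'"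
      unfolding l using 2 ab by (auto intro!: mult_strict_right_mono power_strict_mono)
    finally show ?thesis .
  qed
qed

theorem theorem2:
  fixes a b :: real
  assumes "a > 0" and "b > 0"
  shows "(\<forall>t::nat. t \<ge> 1 \<longrightarrow>
            lambda a b t = sqrt ((real_of_int (i_star a b t) - 2)\<^sup>2 * a\<^sup>2
                               + (real_of_int (j_star a b t) - 2)\<^sup>2 * b\<^sup>2))
       \<and> (\<forall>t::nat. t \<ge> 3 \<longrightarrow>
            (let r = \<bar>real_of_int (i_star a b t) - i_plus a b t\<bar> in
              r = \<bar>real_of_int (j_star a b t) - j_plus a b t\<bar> \<and>
              lambda a b t = sqrt ((real t - 3)\<^sup>2 * a\<^sup>2 * b\<^sup>2 / (a\<^sup>2 + b\<^sup>2)
                                 + r\<^sup>2 * (a\<^sup>2 + b\<^sup>2))))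
       \<and> strict_mono_on {3..} (lambda a b)"
proof (intro conjI allI impI)
  fix t :: nat assume "t \<ge> 1"
  from lambda_eq[OF assms this] obtain u v :: nat where
    "i_star a b t = int u + 2" "j_star a b t = int v + 2"
    "lambda a b t = sqrt ((real u)\<^sup>2 * a\<^sup>2 + (real v)\<^sup>2 * b\<^sup>2)" by blast
  then show "lambda a b t = sqrt ((real_of_int (i_star a b t) - 2)\<^sup>2 * a\<^sup>2
                           + (real_of_int (j_star a b t) - 2)\<^sup>2 * b\<^sup>2)"
    by simp
next
  fix t :: nat assume t: "t \<ge> 3"
  then have "t \<ge> 1" by simp
  from lambda_eq[OF assms this] obtain u v :: nat where uv: "u + v = t - 3"
    "i_star a b t = int u + 2" "j_star a b t = int v + 2"
    "lambda a b t = sqrt ((real u)\<^sup>2 * a\<^sup>2 + (real v)\<^sup>2 * b\<^sup>2)" by blast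
  have n: "real (t - 3) = real t - 3" "real v = real t - 3 - real u" using uv(1) t by linarith+
  \<comment> \<open>Both \<open>i_star + j_star\<close> and \<open>i_plus + j_plus\<close> equal
    \<open>t + 1\<close>, so the rounding errors are opposite.\<close>
  have "(real_of_int (i_star a b t) - i_plus a b t) = - (real_of_int (j_star a b t) - j_plus a b t)"
    by (simp add: uv j_plus_eq[OF assms(1)] n)
  moreover have "lambda a b t = sqrt ((real t - 3)\<^sup>2 * a\<^sup>2 * b\<^sup>2 / (a\<^sup>2 + b\<^sup>2)
                         + (real_of_int (i_star a b t) - i_plus a b t)\<^sup>2 * (a\<^sup>2 + b\<^sup>2))"
    unfolding uv(2,4) n(2) split_quadratic[OF assms] by (simp add: i_plus_eq n)
  ultimately show "let r = \<bar>real_of_int (i_star a b t) - i_plus a b t\<bar> in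
              r = \<bar>real_of_int (j_star a b t) - j_plus a b t\<bar> \<and>
              lambda a b t = sqrt ((real t - 3)\<^sup>2 * a\<^sup>2 * b\<^sup>2 / (a\<^sup>2 + b\<^sup>2)
                                 + r\<^sup>2 * (a\<^sup>2 + b\<^sup>2))"
    by simp
qed (rule strict_mono_on_lambda[OF assms])

end
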